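(* For the coefficient matrix $\mathcal{A}^n_{h\tau}$ defined in the context, the condition number satisfies $$\kappa(\mathcal{A}^n_{h\tau})\lesssim 1+\tau_n^{\alpha_0}h^{-2\gamma},$$ i.e. there is a constant $C>0$, independent of the step sizes $\tau_n$ and $h$, such that $\kappa(\mathcal{A}^n_{h\tau})\le C(1+\tau_n^{\alpha_0}h^{-2\gamma})$.
   Context: Fixed data: an integer $s\ge0$, orders $0<\alpha_s<\cdots<\alpha_1<\alpha_0<1$, $\beta\in(0,1/2)$, $\gamma\in(1/2,1)$, constants $a_0>0$, $a_i\ge0$ ($i=1,\dots,s$), $K_1>0$, $K_2>0$, an interval $(a,b)$ and a final time $T>0$. Discretization: an integer $M$ (number of spatial cells), $h=(b-a)/M$; a temporal mesh $0=t_0<t_1<\cdots<t_N=T$ with step sizes $\tau_n=t_n-t_{n-1}$. The constant $C$ may depend on the fixed data but not on $h$, $\tau_n$. The coefficient matrix is $$\mathcal{A}^n_{h\tau}=\sum_{i=0}^s a_i\frac{\Gamma(3-\alpha_0)\tau_n^{\alpha_0-\alpha_i}}{\Gamma(3-\alpha_i)}M_h+K_1\frac{\Gamma(3-\alpha_0)\tau_n^{\alpha_0}}{2}A_h^\beta+K_2\frac{\Gamma(3-\alpha_0)\tau_n^{\alpha_0}}{2}A_h^\gamma,$$ where $M_h$ is the $(M-1)\times(M-1)$ tridiagonal matrix with diagonal entries $4h/6$ and sub/superdiagonal entries $h/6$, and, for $\mu\in\{\beta,\gamma\}$, $A_h^\mu=(a^{\mu,h}_{i,j})_{(M-1)\times(M-1)}$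 is the symmetric Toeplitz matrix with $$a^{\mu,h}_{i,i}=\frac{h^{1-2\mu}(2^{4-2\mu}-8)}{2\cos(\mu\pi)\Gamma(4-2\mu)},\qquad a^{\mu,h}_{j,j+1}=a^{\mu,h}_{j+1,j}=\frac{h^{1-2\mu}(3^{3-2\mu}-2^{5-2\mu}+7)}{2\cos(\mu\pi)\Gamma(4-2\mu)},$$ and, for $l\ge2$, $$a^{\mu,h}_{k,k+l}=a^{\mu,h}_{k+l,k}=\frac{h^{1-2\mu}}{2\cos(\mu\pi)\Gamma(4-2\mu)}\big[(l+2)^{3-2\mu}-4(l+1)^{3-2\mu}+6l^{3-2\mu}-4(l-1)^{3-2\mu}+(l-2)^{3-2\mu}\big].$$ $\kappa$ denotes the spectral condition number (ratio of the largest to the smallest eigenvalue of this symmetric positive definite matrix). *)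

theory Defs
  imports "HOL-Analysis.Gamma_Function" "Jordan_Normal_Form.Spectral_Radius"
begin

(* Matrix indices run over {0..<M - 1} instead of {1..M - 1}; this is immaterial because all
   entries depend only on the distance of the two indices. *)

definition mass_matrix :: "nat \<Rightarrow> real \<Rightarrow> real mat" where
  "mass_matrix M h = mat (M - 1) (M - 1) (\<lambda>(i, j).
     if i = j then 4 * h / 6
     else if i = j + 1 \<or> j = i + 1 then h / 6
     else 0)"

(* For l = 2 the last summand is 0 powr (3 - 2 * \<mu>) = 0, as intended since 3 - 2 * \<mu> > 0. *)
definition frac_coeff :: "real \<Rightarrow> real \<Rightarrow> nat \<Rightarrow> real" where
  "frac_coeff \<mu> h l =
     h powr (1 - 2 * \<mu>) / (2 * cos (\<mu> * pi) * Gamma (4 - 2 * \<mu>)) *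
     (if l = 0 then 2 powr (4 - 2 * \<mu>) - 8
      else if l = 1 then 3 powr (3 - 2 * \<mu>) - 2 powr (5 - 2 * \<mu>) + 7
      else (real l + 2) powr (3 - 2 * \<mu>) - 4 * (real l + 1) powr (3 - 2 * \<mu>)
           + 6 * real l powr (3 - 2 * \<mu>)
           - 4 * (real l - 1) powr (3 - 2 * \<mu>) + (real l - 2) powr (3 - 2 * \<mu>))"

definition frac_matrix :: "nat \<Rightarrow> real \<Rightarrow> real \<Rightarrow> real mat" where
  "frac_matrix M h \<mu> = mat (M - 1) (M - 1) (\<lambda>(i, j).
     frac_coeff \<mu> h (if j \<le> i then i - j else j - i))"

definition coeff_matrix ::
  "nat \<Rightarrow> (nat \<Rightarrow> real) \<Rightarrow> (nat \<Rightarrow> real) \<Rightarrow> real \<Rightarrow> real \<Rightarrow> real \<Rightarrow> real \<Rightarrow> nat \<Rightarrow> real \<Rightarrow> real \<Rightarrow> real mat"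
where
  "coeff_matrix s \<alpha> c \<beta> \<gamma> K1 K2 M h \<tau> =
     (\<Sum>i = 0..s. c i * (Gamma (3 - \<alpha> 0) * \<tau> powr (\<alpha> 0 - \<alpha> i) / Gamma (3 - \<alpha> i)))
        \<cdot>\<^sub>m mass_matrix M h
     + (K1 * (Gamma (3 - \<alpha> 0) * \<tau> powr \<alpha> 0 / 2)) \<cdot>\<^sub>m frac_matrix M h \<beta>
     + (K2 * (Gamma (3 - \<alpha> 0) * \<tau> powr \<alpha> 0 / 2)) \<cdot>\<^sub>m frac_matrix M h \<gamma>"

(* Meaningful for nonempty symmetric positive definite matrices, whose eigenvalues are all real
   (so that the spectrum over the reals is the whole spectrum) and positive. *)
definition spectral_cond :: "real mat \<Rightarrow> real" where
  "spectral_cond A = Max (spectrum A) / Min (spectrum A)"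

definition is_mesh :: "real \<Rightarrow> nat \<Rightarrow> (nat \<Rightarrow> real) \<Rightarrow> bool" where
  "is_mesh T N t \<longleftrightarrow> t 0 = 0 \<and> t N = T \<and> (\<forall>k<N. t k < t (Suc k))"

end

theory Submission
  imports Defs
begin

text \<open>
  Write \<open>p = 3 - 2 * \<mu>\<close>. Up to a factor, the entries of the fractional matrix are the fourth central
  differences of \<open>\<bar>x\<bar> powr p\<close> at \<open>x = i - j\<close>. By scaling, \<open>\<bar>x\<bar> powr p\<close> is a constant times
  \<open>\<integral> (cos (x * \<xi>) - 1 + e * (x * \<xi>)\<^sup>2 / 2) * \<xi> powr (- 1 - p)\<close> over \<open>\<xi> > 0\<close>, with \<open>e = 0\<close> if
  \<open>p < 2\<close> and \<open>e = 1\<close> if \<open>p > 2\<close>. A fourth difference annihilates the quadratic part and turns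
  \<open>cos (x * \<xi>)\<close> into \<open>(2 - 2 * cos \<xi>)\<^sup>2 * cos (x * \<xi>)\<close>, a positive semidefinite kernel in \<open>i - j\<close>;
  the sign of the constant is that of \<open>p - 2\<close> and hence that of \<open>cos (\<mu> * pi)\<close>, so the fractional
  matrices are positive semidefinite. The smallest eigenvalue of the sum is therefore at least that of
  the mass part, which is of order \<open>h\<close>. Since the fourth differences are
  \<open>O(l powr (p - 4))\<close>, they are absolutely summable, and Gershgorin's bound gives eigenvalues of the
  fractional matrices of order \<open>h powr (1 - 2 * \<mu>)\<close>.
\<close>

section \<open>Positive semidefiniteness of fourth differences of powers\<close>

text \<open>A Taylor remainder of the cosine: for \<open>e = 0\<close> it is quadratically small at
  0 and bounded, for \<open>e = 1\<close> it is quartically small at 0 and grows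
  quadratically.\<close>

definition cos_remainder :: "real \<Rightarrow> real \<Rightarrow> real" where
  "cos_remainder e u = cos u - 1 + e * u\<^sup>2 / 2"

definition fourth_diff :: "(real \<Rightarrow> real) \<Rightarrow> real \<Rightarrow> real" where
  "fourth_diff f d = f (d + 2) - 4 * f (d + 1) + 6 * f d - 4 * f (d - 1) + f (d - 2)"

text \<open>The fourth central difference is the second one applied twice. Under the latter
  \<open>cos (x * \<xi>)\<close> is an eigenfunction with eigenvalue
  \<open>2 * cos \<xi> - 2\<close>, while two applications annihilate constants and
  quadratics.\<close>

lemma fourth_diff_cos_remainder:
  "fourth_diff (\<lambda>x. cos_remainder e (x * \<xi>)) d = (2 - 2 * cos \<xi>)\<^sup>2 * cos (d * \<xi>)"
proof -
  have 1: "cos ((d + 1) * \<xi>) + cos ((d - 1) * \<xi>) = 2 * cos (d * \<xi>) * cos \<xi>"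
    by (simp add: distrib_right left_diff_distrib cos_add cos_diff)
  have 2: "cos ((d + 2) * \<xi>) + cos ((d - 2) * \<xi>) = 2 * cos (d * \<xi>) * (2 * (cos \<xi>)\<^sup>2 - 1)"
    by (simp add: distrib_right left_diff_distrib cos_add cos_diff cos_double_cos)
  have "fourth_diff (\<lambda>x. cos_remainder e (x * \<xi>)) d
      = (cos ((d + 2) * \<xi>) + cos ((d - 2) * \<xi>)) - 4 * (cos ((d + 1) * \<xi>) + cos ((d - 1) * \<xi>))
        + 6 * cos (d * \<xi>)"
    by (simp add: fourth_diff_def cos_remainder_def algebra_simps power2_eq_square
        add_divide_distrib diff_divide_distrib)
  also have "\<dots> = (2 - 2 * cos \<xi>)\<^sup>2 * cos (d * \<xi>)"
    unfolding 1 2 by (simp add: algebra_simps power2_eq_square)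
  finally show ?thesis .
qed

section \<open>Cosine bounds and integrable powers\<close>

lemma cos_ge_one_minus_half_square: "1 - u\<^sup>2 / 2 \<le> cos (u::real)"
proof -
  have "(sin (u / 2))\<^sup>2 \<le> (u / 2)\<^sup>2"
    using abs_sin_x_le_abs_x[of "u / 2"] by (simp only: abs_le_square_iff)
  moreover have "cos u = 1 - 2 * (sin (u / 2))\<^sup>2"
    using cos_double_sin[of "u / 2"] by simp
  ultimately show ?thesis by (simp add: power_divide)
qed

lemma cos_le_quartic: "cos u \<le> 1 - u\<^sup>2 / 2 + u ^ 4 / 24" for u :: real
proof -
  obtain t where t: "cos u = (\<Sum>m<4. cos_coeff m * u ^ m) + (cos (t + 1/2 * real 4 * pi) / fact 4) * u ^ 4"
    using Maclaurin_cos_expansion[of u 4] by blast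
  have "cos (t + 1/2 * real 4 * pi) / fact 4 * u ^ 4 \<le> 1 / 24 * u ^ 4"
    by (intro mult_right_mono) (auto simp: fact_numeral)
  then show ?thesis
    using t by (simp add: cos_coeff_def lessThan_nat_numeral fact_numeral numeral_3_eq_3) (simp add: numeral_2_eq_2 power2_eq_square)
qed

text \<open>Gauge integrability of a nonnegative function gives absolute integrability for the
  completed measure; Borel measurability of the integrand transfers it to
  \<open>lborel\<close>.\<close>

lemma integrable_powr_indicator_0_1:
  assumes "a > -1"
  shows "integrable lborel (\<lambda>x::real. indicator {0<..1} x * x powr a)"
proof -
  have "(\<lambda>x::real. x powr a) absolutely_integrable_on {0<..1}"
    by (intro nonnegative_absolutely_integrable_1 integrable_on_powr_from_0') (use assms in auto)
  then show ?thesis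
    unfolding set_integrable_def by (subst (asm) integrable_completion) auto
qed

lemma integrable_powr_indicator_1_inf:
  assumes "a < -1"
  shows "integrable lborel (\<lambda>x::real. indicator {1..} x * x powr a)"
proof -
  have "(\<lambda>x::real. x powr a) absolutely_integrable_on {1..}"
    by (intro nonnegative_absolutely_integrable_1 has_integral_integrable[OF has_integral_powr_to_inf])
      (use assms in auto)
  then show ?thesis
    unfolding set_integrable_def by (subst (asm) integrable_completion) auto
qed

text \<open>Homogeneity of degree \<open>- 1 - p\<close> is what makes rescaled integrals
  proportional to \<open>x powr p\<close>. The indicator extends the weight by zero, so that
  integrals run over all of \<open>lborel\<close>.\<close>

definition power_weight :: "real \<Rightarrow> real \<Rightarrow> real" where
  "power_weight p \<xi> = indicator {0<..} \<xi> * \<xi> powr (- 1 - p)"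

lemma power_weight_nonneg: "0 \<le> power_weight p \<xi>"
  by (simp add: power_weight_def)

lemma power_weight_measurable [measurable]: "power_weight p \<in> borel_measurable borel"
  unfolding power_weight_def by measurable

lemma power_weight_scale:
  assumes "x > 0"
  shows "power_weight p (\<xi> / x) = x powr (1 + p) * power_weight p \<xi>"
  using assms by (auto simp: power_weight_def indicator_def powr_divide powr_minus powr_diff
      powr_add field_simps zero_less_divide_iff)

text \<open>In both cases \<open>2 * e < p\<close> and \<open>p < 2 * e + 2\<close>: the first gives
  convergence of the weighted integral at infinity, the second at 0. The factor
  \<open>2 * e - 1\<close> in the lemmas below is -1 or 1, the sign of
  \<open>cos_remainder e\<close>.\<close>

locale power_exponent =
  fixes p e :: real
  assumes exponent: "e = 0 \<and> 0 < p \<and> p < 2 \<or> e = 1 \<and> 2 < p \<and> p < 4"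
begin

lemma cos_remainder_sign: "0 \<le> (2 * e - 1) * cos_remainder e u"
  using exponent cos_ge_one_minus_half_square[of u] by (auto simp: cos_remainder_def)

text \<open>Strictness on one interval suffices for a nonzero integral. This one serves both cases:
  below pi the cosine stays under 1, and beyond 2 the term \<open>u\<^sup>2 / 2\<close> exceeds 2,
  the largest value of \<open>1 - cos u\<close>.\<close>

lemma cos_remainder_sign_strict:
  assumes "2 < u" "u < 3"
  shows "0 < (2 * e - 1) * cos_remainder e u"
  using exponent
proof (elim disjE conjE)
  assume "e = 0"
  moreover have "cos u < cos 0"
    by (rule cos_monotone_0_pi) (use assms pi_gt3 in auto)
  ultimately show ?thesis by (simp add: cos_remainder_def)
next
  assume "e = 1"
  moreover have "2\<^sup>2 < u\<^sup>2"
    by (rule power_strict_mono) (use assms in auto)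
  moreover have "- 1 \<le> cos u" by simp
  ultimately show ?thesis by (simp add: cos_remainder_def del: cos_ge_minus_one)
qed

text \<open>The first bound controls the weighted integrand on (0, 1], the second on the rest of the
  half-line.\<close>

lemma cos_remainder_bounds:
  assumes "u > 0"
  shows "\<bar>cos_remainder e u\<bar> \<le> u powr (2 * e + 2)" and "\<bar>cos_remainder e u\<bar> \<le> 2 * u powr (2 * e)"
proof -
  have pw: "u powr 2 = u\<^sup>2" "u powr 4 = u ^ 4"
    using assms by (simp_all flip: powr_numeral)
  note b = cos_ge_one_minus_half_square[of u] cos_le_quartic[of u] cos_le_one[of u]
    cos_ge_minus_one[of u]
  have pos: "0 < u\<^sup>2" "0 < u ^ 4" using assms by auto
  from exponent have "e = 0 \<or> e = 1" by auto
  then have "\<bar>cos_remainder e u\<bar> \<le> u powr (2 * e + 2) \<and> \<bar>cos_remainder e u\<bar> \<le> 2 * u powr (2 * e)"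
  proof
    assume "e = 0"
    then show ?thesis using b pos assms unfolding cos_remainder_def abs_le_iff by (simp add: pw del: cos_ge_minus_one cos_le_one)
  next
    assume "e = 1"
    then show ?thesis using b pos assms unfolding cos_remainder_def abs_le_iff by (simp add: pw del: cos_ge_minus_one cos_le_one)
  qed
  then show "\<bar>cos_remainder e u\<bar> \<le> u powr (2 * e + 2)"
    and "\<bar>cos_remainder e u\<bar> \<le> 2 * u powr (2 * e)" by auto
qed

lemma cos_remainder_measurable [measurable]: "cos_remainder e \<in> borel_measurable borel"
  unfolding cos_remainder_def by measurable

lemma integrable_base: "integrable lborel (\<lambda>\<xi>. cos_remainder e \<xi> * power_weight p \<xi>)"
proof (rule Bochner_Integration.integrable_bound)
  show "integrable lborel (\<lambda>\<xi>::real. indicator {0<..1} \<xi> * \<xi> powr (2 * e + 1 - p)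
          + 2 * (indicator {1..} \<xi> * \<xi> powr (2 * e - 1 - p)))"
    by (intro Bochner_Integration.integrable_add Bochner_Integration.integrable_mult_right
        integrable_powr_indicator_0_1 integrable_powr_indicator_1_inf) (use exponent in auto)
  show "AE \<xi> in lborel. norm (cos_remainder e \<xi> * power_weight p \<xi>) \<le> norm (indicator {0<..1} \<xi> * \<xi> powr (2 * e + 1 - p)
          + 2 * (indicator {1..} \<xi> * \<xi> powr (2 * e - 1 - p)))"
  proof (rule AE_I2)
    fix \<xi> :: real
    show "norm (cos_remainder e \<xi> * power_weight p \<xi>) \<le> norm (indicator {0<..1} \<xi> * \<xi> powr (2 * e + 1 - p)
          + 2 * (indicator {1..} \<xi> * \<xi> powr (2 * e - 1 - p)))"
    proof (cases "\<xi> > 0")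
      case True
      have exps: "\<xi> powr (2 * e + 1 - p) = \<xi> powr (2 * e + 2) * \<xi> powr (- 1 - p)" "\<xi> powr (2 * e - 1 - p) = \<xi> powr (2 * e) * \<xi> powr (- 1 - p)"
        by (simp_all flip: powr_add) (simp_all add: algebra_simps)
      have 1: "\<bar>cos_remainder e \<xi>\<bar> * \<xi> powr (- 1 - p) \<le> \<xi> powr (2 * e + 1 - p)"
        using mult_right_mono[OF cos_remainder_bounds(1)[OF True], of "\<xi> powr (- 1 - p)"]
        by (simp add: exps)
      have 2: "\<bar>cos_remainder e \<xi>\<bar> * \<xi> powr (- 1 - p) \<le> 2 * \<xi> powr (2 * e - 1 - p)"
        using mult_right_mono[OF cos_remainder_bounds(2)[OF True], of "\<xi> powr (- 1 - p)"]
        by (simp add: exps mult.assoc)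
      show ?thesis
      proof (cases "\<xi> \<le> 1")
        case le: True
        have "norm (cos_remainder e \<xi> * power_weight p \<xi>) = \<bar>cos_remainder e \<xi>\<bar> * \<xi> powr (- 1 - p)"
          using True by (simp add: abs_mult power_weight_def)
        \<comment> \<open>At \<open>\<xi> = 1\<close> both indicators are active, which only
          enlarges the majorant.\<close>
        then show ?thesis
          using 1 True le by (cases "\<xi> = 1") (auto simp: indicator_def)
      next
        case False
        then show ?thesis
          using 2 True by (simp add: indicator_def abs_mult power_weight_def)
      qed
    qed (simp add: power_weight_def)
  qed
qed measurable

text \<open>Substitution of \<open>x * \<xi>\<close>: the weight contributes
  \<open>x powr (1 + p)\<close> and the Jacobian removes one factor \<open>x\<close>. For
  \<open>x = 0\<close> both sides vanish, as \<open>cos_remainder e 0 = 0\<close> and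
  \<open>0 powr p = 0\<close>.\<close>

lemma cos_remainder_scale:
  assumes "x \<ge> 0"
  shows "integrable lborel (\<lambda>\<xi>. cos_remainder e (x * \<xi>) * power_weight p \<xi>)"
    and "(\<integral>\<xi>. cos_remainder e (x * \<xi>) * power_weight p \<xi> \<partial>lborel)
      = x powr p * (\<integral>\<xi>. cos_remainder e \<xi> * power_weight p \<xi> \<partial>lborel)"
proof -
  let ?f = "\<lambda>\<xi>. cos_remainder e \<xi> * power_weight p \<xi>"
  have "integrable lborel (\<lambda>\<xi>. cos_remainder e (x * \<xi>) * power_weight p \<xi>) \<and>
    (\<integral>\<xi>. cos_remainder e (x * \<xi>) * power_weight p \<xi> \<partial>lborel) = x powr p * (\<integral>\<xi>. ?f \<xi> \<partial>lborel)"
  proof (cases "x = 0")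
    case True
    then show ?thesis by (simp add: cos_remainder_def)
  next
    case False
    with assms have x: "x > 0" by simp
    have eq: "cos_remainder e (x * \<xi>) * power_weight p \<xi> = x powr (1 + p) * ?f (0 + x * \<xi>)" for \<xi>
      using power_weight_scale[OF x, of p "x * \<xi>"] x by simp
    have "(\<integral>\<xi>. ?f \<xi> \<partial>lborel) = x * (\<integral>\<xi>. ?f (0 + x * \<xi>) \<partial>lborel)"
      using lborel_integral_real_affine[of x ?f 0] x by simp
    then show ?thesis
      unfolding eq using lborel_integrable_real_affine[OF integrable_base, of x 0] x
      by (simp add: powr_add)
  qed
  then show "integrable lborel (\<lambda>\<xi>. cos_remainder e (x * \<xi>) * power_weight p \<xi>)"
    and "(\<integral>\<xi>. cos_remainder e (x * \<xi>) * power_weight p \<xi> \<partial>lborel)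
      = x powr p * (\<integral>\<xi>. cos_remainder e \<xi> * power_weight p \<xi> \<partial>lborel)" by auto
qed

lemma abs_powr_integral:
  shows "integrable lborel (\<lambda>\<xi>. cos_remainder e (x * \<xi>) * power_weight p \<xi>)"
    and "(\<integral>\<xi>. cos_remainder e (x * \<xi>) * power_weight p \<xi> \<partial>lborel)
      = \<bar>x\<bar> powr p * (\<integral>\<xi>. cos_remainder e \<xi> * power_weight p \<xi> \<partial>lborel)"
proof -
  have "cos_remainder e (x * \<xi>) = cos_remainder e (\<bar>x\<bar> * \<xi>)" for \<xi>
    by (cases "x \<ge> 0") (auto simp: cos_remainder_def)
  then show "integrable lborel (\<lambda>\<xi>. cos_remainder e (x * \<xi>) * power_weight p \<xi>)"
    and "(\<integral>\<xi>. cos_remainder e (x * \<xi>) * power_weight p \<xi> \<partial>lborel)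
      = \<bar>x\<bar> powr p * (\<integral>\<xi>. cos_remainder e \<xi> * power_weight p \<xi> \<partial>lborel)"
    using cos_remainder_scale[of "\<bar>x\<bar>"] by auto
qed

text \<open>The signed integrand is nonnegative, so a zero integral would force it to vanish almost
  everywhere, against strict positivity on an interval.\<close>

lemma base_integral_sign:
  "0 < (2 * e - 1) * (\<integral>\<xi>. cos_remainder e \<xi> * power_weight p \<xi> \<partial>lborel)"
proof -
  let ?g = "\<lambda>\<xi>. (2 * e - 1) * (cos_remainder e \<xi> * power_weight p \<xi>)"
  have int: "integrable lborel ?g"
    by (intro Bochner_Integration.integrable_mult_right integrable_base)
  have nonneg: "0 \<le> ?g \<xi>" for \<xi>
    using mult_nonneg_nonneg[OF cos_remainder_sign power_weight_nonneg] by (simp add: mult.assoc)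
  have "(\<integral>\<xi>. ?g \<xi> \<partial>lborel) \<noteq> 0"
  proof
    assume "(\<integral>\<xi>. ?g \<xi> \<partial>lborel) = 0"
    then have "AE \<xi> in lborel. ?g \<xi> = 0"
      using integral_nonneg_eq_0_iff_AE[OF int] nonneg by auto
    moreover have "?g \<xi> \<noteq> 0" if "\<xi> \<in> {2<..<3}" for \<xi>
      using cos_remainder_sign_strict[of \<xi>] that by (auto simp: power_weight_def)
    ultimately have "AE \<xi> in lborel. \<xi> \<notin> {2<..<3::real}"
      by (elim AE_mp) (intro AE_I2, blast)
    then have "{2<..<3::real} \<in> null_sets lborel"
      by (subst AE_iff_null_sets) auto
    then show False by (simp add: null_sets_def)
  qed
  moreover have "0 \<le> (\<integral>\<xi>. ?g \<xi> \<partial>lborel)"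
    by (rule Bochner_Integration.integral_nonneg) (rule nonneg)
  ultimately have "0 < (\<integral>\<xi>. ?g \<xi> \<partial>lborel)" by linarith
  then show ?thesis by simp
qed

text \<open>Linearity applied to the five nodes of the stencil. Up to a nonzero constant, this
  exhibits the fourth difference as the cosine transform of a nonnegative density.\<close>

lemma fourth_diff_powr_integral:
  shows "integrable lborel (\<lambda>\<xi>. (2 - 2 * cos \<xi>)\<^sup>2 * cos (d * \<xi>) * power_weight p \<xi>)"
    and "(\<integral>\<xi>. (2 - 2 * cos \<xi>)\<^sup>2 * cos (d * \<xi>) * power_weight p \<xi> \<partial>lborel)
     = fourth_diff (\<lambda>x. \<bar>x\<bar> powr p) d * (\<integral>\<xi>. cos_remainder e \<xi> * power_weight p \<xi> \<partial>lborel)"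
proof -
  let ?h = "\<lambda>x \<xi>. cos_remainder e (x * \<xi>) * power_weight p \<xi>"
  have eq: "(2 - 2 * cos \<xi>)\<^sup>2 * cos (d * \<xi>) * power_weight p \<xi>
    = ?h (d + 2) \<xi> - 4 * ?h (d + 1) \<xi> + 6 * ?h d \<xi> - 4 * ?h (d - 1) \<xi> + ?h (d - 2) \<xi>" for \<xi>
    unfolding fourth_diff_cos_remainder[of e \<xi> d, symmetric] fourth_diff_def by (simp add: algebra_simps)
  show "integrable lborel (\<lambda>\<xi>. (2 - 2 * cos \<xi>)\<^sup>2 * cos (d * \<xi>) * power_weight p \<xi>)"
    unfolding eq
    by (intro Bochner_Integration.integrable_add Bochner_Integration.integrable_diff
        Bochner_Integration.integrable_mult_right abs_powr_integral(1))
  show "(\<integral>\<xi>. (2 - 2 * cos \<xi>)\<^sup>2 * cos (d * \<xi>) * power_weight p \<xi> \<partial>lborel)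
     = fourth_diff (\<lambda>x. \<bar>x\<bar> powr p) d * (\<integral>\<xi>. cos_remainder e \<xi> * power_weight p \<xi> \<partial>lborel)"
    unfolding eq
    by (simp only: Bochner_Integration.integral_add Bochner_Integration.integral_diff
        Bochner_Integration.integral_mult_right Bochner_Integration.integrable_add
        Bochner_Integration.integrable_diff Bochner_Integration.integrable_mult_right abs_powr_integral)
      (simp add: fourth_diff_def algebra_simps)
qed

lemma fourth_diff_powr_form_sign:
  fixes v :: "nat \<Rightarrow> real"
  shows "0 \<le> (2 * e - 1) * (\<Sum>i<n. \<Sum>j<n. fourth_diff (\<lambda>x. \<bar>x\<bar> powr p) (real i - real j) * v i * v j)"
    (is "0 \<le> _ * ?Q")
proof -
  let ?I = "\<integral>\<xi>. cos_remainder e \<xi> * power_weight p \<xi> \<partial>lborel"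
  let ?k = "\<lambda>d \<xi>. (2 - 2 * cos \<xi>)\<^sup>2 * cos (d * \<xi>) * power_weight p \<xi>"
  \<comment> \<open>The squared modulus of the trigonometric polynomial with coefficients
    \<open>v i\<close>, split into real and imaginary parts.\<close>
  have form: "(\<Sum>i<n. \<Sum>j<n. cos ((real i - real j) * \<xi>) * v i * v j)
    = (\<Sum>i<n. cos (i * \<xi>) * v i)\<^sup>2 + (\<Sum>i<n. sin (i * \<xi>) * v i)\<^sup>2" for \<xi> :: real
  proof -
    have "cos ((real i - real j) * \<xi>) * v i * v j
      = (cos (i * \<xi>) * v i) * (cos (j * \<xi>) * v j) + (sin (i * \<xi>) * v i) * (sin (j * \<xi>) * v j)" for i j
      by (simp add: left_diff_distrib cos_diff) (simp add: algebra_simps)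
    then show ?thesis by (simp only: power2_eq_square sum_product sum.distrib)
  qed
  have "?Q * ?I = (\<Sum>i<n. \<Sum>j<n. (\<integral>\<xi>. ?k (real i - real j) \<xi> \<partial>lborel) * (v i * v j))"
    unfolding fourth_diff_powr_integral(2) by (simp add: sum_distrib_left sum_distrib_right mult_ac)
  also have "\<dots> = (\<integral>\<xi>. (\<Sum>i<n. \<Sum>j<n. ?k (real i - real j) \<xi> * (v i * v j)) \<partial>lborel)"
    using fourth_diff_powr_integral(1)
    by (simp add: Bochner_Integration.integral_sum Bochner_Integration.integrable_sum)
  also have "\<dots> = (\<integral>\<xi>. (2 - 2 * cos \<xi>)\<^sup>2 * power_weight p \<xi> *
      (\<Sum>i<n. \<Sum>j<n. cos ((real i - real j) * \<xi>) * v i * v j) \<partial>lborel)"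
    by (simp add: sum_distrib_left mult_ac)
  also have "\<dots> \<ge> 0"
    by (intro Bochner_Integration.integral_nonneg mult_nonneg_nonneg power_weight_nonneg)
      (simp_all add: form)
  finally have "0 \<le> ?Q * ?I" .
  \<comment> \<open>The sign squares to 1, so it can be inserted into both factors; positivity of
    the signed base integral then gives the sign of \<open>?Q\<close>.\<close>
  moreover have "((2 * e - 1) * x) * ((2 * e - 1) * y) = x * y" for x y
    using exponent by auto
  ultimately have "0 \<le> ((2 * e - 1) * ?Q) * ((2 * e - 1) * ?I)"
    by (simp only:)
  then show ?thesis
    using base_integral_sign by (simp add: zero_le_mult_iff)
qed

end

section \<open>Summability of fourth differences of powers\<close>

text \<open>The stencil annihilates cubic polynomials, so only the Taylor remainders at
  \<open>c\<close> survive. They sum to at most \<open>(16 + 4 + 4 + 16) / 24 * B\<close>, which is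
  below \<open>2 * B\<close>.\<close>

lemma fourth_diff_le_fourth_derivative:
  fixes D :: "nat \<Rightarrow> real \<Rightarrow> real"
  assumes D: "\<And>m t. m < 4 \<Longrightarrow> c - 2 \<le> t \<Longrightarrow> t \<le> c + 2 \<Longrightarrow> DERIV (D m) t :> D (Suc m) t"
    and B: "\<And>t. c - 2 \<le> t \<Longrightarrow> t \<le> c + 2 \<Longrightarrow> \<bar>D 4 t\<bar> \<le> B"
  shows "\<bar>fourth_diff (D 0) c\<bar> \<le> 2 * B"
proof -
  define r where "r s = D 0 (c + s) - (\<Sum>m<4. D m c / fact m * s ^ m)" for s
  have r: "\<bar>r s\<bar> \<le> B / 24 * s ^ 4" if s: "s \<in> {-2, -1, 1, 2}" for s
  proof -
    have "\<exists>t. (if c + s < c then c + s < t \<and> t < c else c < t \<and> t < c + s) \<and>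
      D 0 (c + s) = (\<Sum>m<4. D m c / fact m * (c + s - c) ^ m) + D 4 t / fact 4 * (c + s - c) ^ 4"
      by (rule Taylor[where a = "c - 2" and b = "c + 2"]) (use D s in auto)
    then obtain t where "if c + s < c then c + s < t \<and> t < c else c < t \<and> t < c + s"
      and eq: "D 0 (c + s) = (\<Sum>m<4. D m c / fact m * s ^ m) + D 4 t / fact 4 * s ^ 4"
      by auto
    then have t: "c - 2 \<le> t" "t \<le> c + 2"
      using s by (auto split: if_splits)
    have "r s = D 4 t / 24 * s ^ 4"
      unfolding r_def eq by (simp add: fact_numeral)
    then have "\<bar>r s\<bar> = \<bar>D 4 t\<bar> / 24 * s ^ 4"
      by (simp only: abs_mult abs_divide power_even_abs_numeral power_abs) simp
    moreover have "\<bar>D 4 t\<bar> * s ^ 4 \<le> B * s ^ 4"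
      by (intro mult_right_mono B t) simp
    ultimately show ?thesis by simp
  qed
  \<comment> \<open>The central node drops out because \<open>r 0 = 0\<close>.\<close>
  have "fourth_diff (D 0) c = r 2 - 4 * r 1 - 4 * r (-1) + r (-2)"
    by (simp add: fourth_diff_def r_def lessThan_nat_numeral fact_numeral numeral_3_eq_3 field_simps)
  moreover have "B \<ge> 0" using B[of c] by auto
  ultimately show ?thesis
    using r[of 1] r[of 2] r[of "-1"] r[of "-2"] by simp
qed

text \<open>For \<open>2 < c\<close> the whole stencil lies in the positive reals, where the power
  is smooth. Since \<open>p < 4\<close>, the power in its fourth derivative is decreasing and is
  largest at the left end \<open>c - 2\<close>.\<close>

lemma abs_fourth_diff_powr_le:
  assumes "p < 4" "2 < c"
  shows "\<bar>fourth_diff (\<lambda>x. \<bar>x\<bar> powr p) c\<bar> \<le> 2 * (\<bar>\<Prod>k<4. p - real k\<bar> * (c - 2) powr (p - 4))"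
proof -
  define D where "D m t = (\<Prod>k<m. p - real k) * t powr (p - real m)" for m t
  have "\<bar>fourth_diff (D 0) c\<bar> \<le> 2 * (\<bar>\<Prod>k<4. p - real k\<bar> * (c - 2) powr (p - 4))"
  proof (rule fourth_diff_le_fourth_derivative)
    show "DERIV (D m) t :> D (Suc m) t" if "c - 2 \<le> t" for m t
      unfolding D_def using that assms
      by (auto intro!: derivative_eq_intros simp: algebra_simps)
    show "\<bar>D 4 t\<bar> \<le> \<bar>\<Prod>k<4. p - real k\<bar> * (c - 2) powr (p - 4)" if "c - 2 \<le> t" for t
      unfolding D_def abs_mult using that assms
      by (intro mult_left_mono) (auto intro!: powr_mono2')
  qed
  moreover have "fourth_diff (D 0) c = fourth_diff (\<lambda>x. \<bar>x\<bar> powr p) c"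
    using assms by (simp add: fourth_diff_def D_def)
  ultimately show ?thesis by simp
qed

lemma summable_abs_fourth_diff_powr:
  assumes "p < 3"
  shows "summable (\<lambda>l. \<bar>fourth_diff (\<lambda>x. \<bar>x\<bar> powr p) (real l)\<bar>)"
proof -
  have "summable (\<lambda>l. real l powr (p - 4))"
    using assms by (simp add: summable_real_powr_iff)
  then have "summable (\<lambda>l. 2 * (\<bar>\<Prod>k<4. p - real k\<bar> * real (l + 1) powr (p - 4)))"
    by (intro summable_mult summable_ignore_initial_segment)
  \<comment> \<open>Shifting by 3 is the least shift that puts every index above 2; the left end of
    the stencil becomes \<open>l + 1\<close>.\<close>
  then have "summable (\<lambda>l. \<bar>fourth_diff (\<lambda>x. \<bar>x\<bar> powr p) (real (l + 3))\<bar>)"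
  proof (rule summable_comparison_test')
    fix l :: nat
    show "norm \<bar>fourth_diff (\<lambda>x. \<bar>x\<bar> powr p) (real (l + 3))\<bar>
      \<le> 2 * (\<bar>\<Prod>k<4. p - real k\<bar> * real (l + 1) powr (p - 4))"
      using abs_fourth_diff_powr_le[of p "real (l + 3)"] assms by (simp add: add_ac)
  qed
  then show ?thesis by (subst (asm) summable_iff_shift)
qed

text \<open>On either side of the diagonal each distance occurs at most once, so both halves of a
  row are partial sums of the series.\<close>

lemma sum_toeplitz_row_le:
  fixes f :: "nat \<Rightarrow> real"
  assumes f: "summable f" and nonneg: "\<And>l. 0 \<le> f l"
  shows "(\<Sum>j<n. f (if j \<le> i then i - j else j - i)) \<le> 2 * suminf f"
proof -
  have part: "(\<Sum>j\<in>S. f (g j)) \<le> suminf f" if "finite S" "inj_on g S" for S :: "nat set" and g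
    using sum_le_suminf[OF f, of "g ` S"] that nonneg by (simp add: sum.reindex)
  have "(\<Sum>j<n. f (if j \<le> i then i - j else j - i))
      = (\<Sum>j\<in>{..<n} \<inter> {..i}. f (i - j)) + (\<Sum>j\<in>{..<n} \<inter> {i<..}. f (j - i))"
  proof -
    have "(\<Sum>j<n. f (if j \<le> i then i - j else j - i)) = (\<Sum>j\<in>({..<n} \<inter> {..i}) \<union> ({..<n} \<inter> {i<..}). f (if j \<le> i then i - j else j - i))"
      by (rule sum.cong) auto
    also have "\<dots> = (\<Sum>j\<in>{..<n} \<inter> {..i}. f (if j \<le> i then i - j else j - i)) + (\<Sum>j\<in>{..<n} \<inter> {i<..}. f (if j \<le> i then i - j else j - i))"
      by (rule sum.union_disjoint) auto
    finally show ?thesis by simp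
  qed
  also have "\<dots> \<le> suminf f + suminf f"
    by (intro add_mono part) (auto simp: inj_on_def)
  finally show ?thesis by simp
qed

section \<open>Eigenvalue bounds for real symmetric matrices\<close>

text \<open>Kept general in the field because it serves both a real matrix and its
  complexification.\<close>

lemma eigenvalue_iff_coordinates:
  fixes A :: "'a::field mat"
  assumes A: "A \<in> carrier_mat n n"
  shows "eigenvalue A k \<longleftrightarrow>
    (\<exists>v. (\<exists>i<n. v i \<noteq> 0) \<and> (\<forall>i<n. (\<Sum>j<n. A $$ (i, j) * v j) = k * v i))"
proof
  assume "eigenvalue A k"
  then obtain v where v: "v \<in> carrier_vec n" "v \<noteq> 0\<^sub>v n" "A *\<^sub>v v = k \<cdot>\<^sub>v v"
    using A by (auto simp: eigenvalue_def eigenvector_def)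
  have "(\<Sum>j<n. A $$ (i, j) * v $ j) = k * v $ i" if "i < n" for i
    using arg_cong[OF v(3), of "\<lambda>w. w $ i"] that v(1) A
    by (simp add: scalar_prod_def lessThan_atLeast0)
  moreover have "\<exists>i<n. v $ i \<noteq> 0"
    using v(1,2) by (metis eq_vecI carrier_vecD index_zero_vec)
  ultimately show "\<exists>v. (\<exists>i<n. v i \<noteq> 0) \<and> (\<forall>i<n. (\<Sum>j<n. A $$ (i, j) * v j) = k * v i)"
    by blast
next
  assume "\<exists>v. (\<exists>i<n. v i \<noteq> 0) \<and> (\<forall>i<n. (\<Sum>j<n. A $$ (i, j) * v j) = k * v i)"
  then obtain v i where v: "i < n" "v i \<noteq> 0" "\<And>i. i < n \<Longrightarrow> (\<Sum>j<n. A $$ (i, j) * v j) = k * v i"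
    by blast
  have "vec n v \<noteq> 0\<^sub>v n"
    using v(1,2) by (metis index_vec index_zero_vec(1))
  moreover have "A *\<^sub>v vec n v = k \<cdot>\<^sub>v vec n v"
    using A v(3) by (intro eq_vecI) (auto simp: scalar_prod_def lessThan_atLeast0)
  ultimately show "eigenvalue A k"
    unfolding eigenvalue_def eigenvector_def using A by (intro exI[of _ "vec n v"]) auto
qed

text \<open>Needed for \<open>Max\<close> and \<open>Min\<close> of the real spectrum to be
  meaningful. A complex eigenvalue exists; symmetry makes it real, and then the real or the
  imaginary part of its eigenvector is a real eigenvector.\<close>

lemma symmetric_spectrum_nonempty:
  fixes A :: "real mat"
  assumes A: "A \<in> carrier_mat n n" and n: "0 < n"
    and sym: "\<And>i j. i < n \<Longrightarrow> j < n \<Longrightarrow> A $$ (i, j) = A $$ (j, i)"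
  shows "spectrum A \<noteq> {}"
proof -
  let ?C = "map_mat complex_of_real A"
  have C: "?C \<in> carrier_mat n n" using A by simp
  obtain k where "eigenvalue ?C k"
    using spectrum_non_empty[OF C n] by (auto simp: spectrum_def)
  then obtain v l where l: "l < n" "v l \<noteq> 0"
    and v: "\<And>i. i < n \<Longrightarrow> (\<Sum>j<n. complex_of_real (A $$ (i, j)) * v j) = k * v i"
    using A by (auto simp: eigenvalue_iff_coordinates[OF C])
  define N where "N = (\<Sum>i<n. (norm (v i))\<^sup>2)"
  have "(norm (v l))\<^sup>2 \<le> N"
    unfolding N_def by (rule member_le_sum) (use l in auto)
  with l have N: "N > 0"
    by (smt (verit) norm_eq_zero zero_less_power2)
  \<comment> \<open>The Hermitian form at the eigenvector; conjugation merely exchanges its two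
    indices, so the value is real.\<close>
  have kN: "k * of_real N = (\<Sum>i<n. \<Sum>j<n. of_real (A $$ (i, j)) * v j * cnj (v i))"
    unfolding N_def of_real_sum sum_distrib_left
  proof (rule sum.cong[OF refl])
    fix i assume "i \<in> {..<n}"
    then show "k * of_real ((norm (v i))\<^sup>2) = (\<Sum>j<n. of_real (A $$ (i, j)) * v j * cnj (v i))"
      by (simp only: complex_norm_square flip: sum_distrib_right mult.assoc) (simp add: v)
  qed
  have "cnj (k * of_real N) = (\<Sum>i<n. \<Sum>j<n. of_real (A $$ (i, j)) * cnj (v j) * v i)"
    unfolding kN by simp
  also have "\<dots> = (\<Sum>j<n. \<Sum>i<n. of_real (A $$ (i, j)) * cnj (v j) * v i)"
    by (rule sum.swap)
  also have "\<dots> = k * of_real N"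
    unfolding kN by (intro sum.cong) (auto simp: sym mult_ac)
  finally have "k \<in> \<real>"
    using N by (simp add: Reals_cnj_iff)
  then obtain r where r: "k = of_real r" by (auto elim: Reals_cases)
  have Re: "(\<Sum>j<n. A $$ (i, j) * Re (v j)) = r * Re (v i)"
    and Im: "(\<Sum>j<n. A $$ (i, j) * Im (v j)) = r * Im (v i)" if "i < n" for i
    using arg_cong[OF v[OF that], of Re] arg_cong[OF v[OF that], of Im] by (simp_all add: r)
  have "Re (v l) \<noteq> 0 \<or> Im (v l) \<noteq> 0"
    using l by (auto simp: complex_eq_iff)
  then have "eigenvalue A r"
    unfolding eigenvalue_iff_coordinates[OF A]
  proof
    assume "Re (v l) \<noteq> 0"
    then show "\<exists>w. (\<exists>i<n. w i \<noteq> 0) \<and> (\<forall>i<n. (\<Sum>j<n. A $$ (i, j) * w j) = r * w i)"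
      using Re l by (intro exI[of _ "\<lambda>i. Re (v i)"]) auto
  next
    assume "Im (v l) \<noteq> 0"
    then show "\<exists>w. (\<exists>i<n. w i \<noteq> 0) \<and> (\<forall>i<n. (\<Sum>j<n. A $$ (i, j) * w j) = r * w i)"
      using Im l by (intro exI[of _ "\<lambda>i. Im (v i)"]) auto
  qed
  then show ?thesis by (auto simp: spectrum_def)
qed

text \<open>Gershgorin's argument: the eigenvalue equation is read at a coordinate of largest
  modulus.\<close>

lemma eigenvalue_le_row_sum:
  fixes A :: "real mat"
  assumes A: "A \<in> carrier_mat n n" and k: "eigenvalue A k"
    and row: "\<And>i. i < n \<Longrightarrow> (\<Sum>j<n. \<bar>A $$ (i, j)\<bar>) \<le> R"
  shows "\<bar>k\<bar> \<le> R"
proof -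
  obtain v l where l: "l < n" "v l \<noteq> 0" and v: "\<And>i. i < n \<Longrightarrow> (\<Sum>j<n. A $$ (i, j) * v j) = k * v i"
    using k unfolding eigenvalue_iff_coordinates[OF A] by blast
  define w where "w = Max ((\<lambda>i. \<bar>v i\<bar>) ` {..<n})"
  have "w \<in> (\<lambda>i. \<bar>v i\<bar>) ` {..<n}"
    unfolding w_def using l by (intro Max_in) auto
  then obtain i where i: "i < n" "w = \<bar>v i\<bar>" by auto
  have w: "\<bar>v j\<bar> \<le> w" if "j < n" for j
    unfolding w_def using that by (intro Max_ge) auto
  have "w > 0" using w[of l] l by auto
  have "\<bar>k\<bar> * w = \<bar>\<Sum>j<n. A $$ (i, j) * v j\<bar>"
    by (simp add: v i abs_mult)
  also have "\<dots> \<le> (\<Sum>j<n. \<bar>A $$ (i, j)\<bar> * w)"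
    by (intro order_trans[OF sum_abs] sum_mono) (auto simp: abs_mult intro!: mult_left_mono w)
  also have "\<dots> \<le> R * w"
    unfolding sum_distrib_right[symmetric] using row[OF i(1)] \<open>w > 0\<close> by simp
  finally show ?thesis using \<open>w > 0\<close> by simp
qed

text \<open>The Rayleigh quotient of an eigenvector is its eigenvalue.\<close>

lemma eigenvalue_ge_quadratic_form:
  fixes A :: "real mat"
  assumes A: "A \<in> carrier_mat n n" and k: "eigenvalue A k"
    and form: "\<And>v :: nat \<Rightarrow> real. q * (\<Sum>i<n. (v i)\<^sup>2) \<le> (\<Sum>i<n. \<Sum>j<n. A $$ (i, j) * v i * v j)"
  shows "q \<le> k"
proof -
  obtain v l where l: "l < n" "v l \<noteq> 0" and v: "\<And>i. i < n \<Longrightarrow> (\<Sum>j<n. A $$ (i, j) * v j) = k * v i"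
    using k unfolding eigenvalue_iff_coordinates[OF A] by blast
  have "(v l)\<^sup>2 \<le> (\<Sum>i<n. (v i)\<^sup>2)"
    by (rule member_le_sum) (use l in auto)
  with l have pos: "0 < (\<Sum>i<n. (v i)\<^sup>2)"
    by (smt (verit) zero_less_power2)
  have "(\<Sum>i<n. \<Sum>j<n. A $$ (i, j) * v i * v j) = (\<Sum>i<n. v i * (\<Sum>j<n. A $$ (i, j) * v j))"
    by (simp add: sum_distrib_left mult_ac)
  also have "\<dots> = (\<Sum>i<n. v i * (k * v i))"
    by (simp add: v)
  also have "\<dots> = k * (\<Sum>i<n. (v i)\<^sup>2)"
    by (simp add: sum_distrib_left power2_eq_square mult_ac)
  finally show ?thesis using form[of v] pos by simp
qed

lemma spectral_cond_le:
  fixes A :: "real mat"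
  assumes A: "A \<in> carrier_mat n n" and n: "0 < n"
    and sym: "\<And>i j. i < n \<Longrightarrow> j < n \<Longrightarrow> A $$ (i, j) = A $$ (j, i)"
    and q: "0 < q"
    and form: "\<And>v :: nat \<Rightarrow> real. q * (\<Sum>i<n. (v i)\<^sup>2) \<le> (\<Sum>i<n. \<Sum>j<n. A $$ (i, j) * v i * v j)"
    and row: "\<And>i. i < n \<Longrightarrow> (\<Sum>j<n. \<bar>A $$ (i, j)\<bar>) \<le> R"
  shows "spectral_cond A \<le> R / q"
proof -
  have fin: "finite (spectrum A)"
    using card_finite_spectrum[OF A] by simp
  have ne: "spectrum A \<noteq> {}"
    by (rule symmetric_spectrum_nonempty[OF A n sym])
  have "Max (spectrum A) \<le> R"
    using Max_in[OF fin ne] eigenvalue_le_row_sum[OF A _ row] by (force simp: spectrum_def)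
  moreover have "q \<le> Min (spectrum A)"
    using Min_in[OF fin ne] eigenvalue_ge_quadratic_form[OF A _ form] by (force simp: spectrum_def)
  moreover have "0 \<le> R"
    using row[OF n] by (meson order_trans sum_nonneg abs_ge_zero)
  ultimately show ?thesis
    unfolding spectral_cond_def using q by (intro frac_le) auto
qed

section \<open>The condition number\<close>

lemma mass_form_ge:
  fixes v :: "nat \<Rightarrow> real"
  shows "(\<Sum>i<n. (v i)\<^sup>2) \<le> (\<Sum>i<n. \<Sum>j<n. (if i = j then 2 else if i = j + 1 \<or> j = i + 1 then 1 / 2 else 0) * v i * v j)"
    (is "?S n \<le> ?Q n")
proof -
  let ?m = "\<lambda>i j :: nat. if i = j then 2 else if i = j + 1 \<or> j = i + 1 then 1 / 2 else 0 :: real"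
  have last_row: "(\<Sum>j<n. ?m n j * v n * v j) = (if n = 0 then 0 else v n * v (n - 1) / 2)" for n
  proof (cases n)
    case (Suc k)
    have "(\<Sum>j<k. ?m (Suc k) j * v (Suc k) * v j) = 0"
      by (rule sum.neutral) auto
    then show ?thesis using Suc by simp
  qed simp
  have step: "?Q (Suc n) = ?Q n + (if n = 0 then 0 else v n * v (n - 1)) + 2 * (v n)\<^sup>2" for n
  proof -
    have "?Q (Suc n) = ?Q n + (\<Sum>i<n. ?m i n * v i * v n) + (\<Sum>j<n. ?m n j * v n * v j) + ?m n n * v n * v n"
      by (simp add: sum.distrib)
    also have "(\<Sum>i<n. ?m i n * v i * v n) = (\<Sum>j<n. ?m n j * v n * v j)"
      by (rule sum.cong) auto
    finally show ?thesis unfolding last_row by (simp add: power2_eq_square)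
  qed
  \<comment> \<open>The induction is strengthened by half of the last square, which absorbs the
    coupling of \<open>v n\<close> with \<open>v (n - 1)\<close> when a row is added.\<close>
  have "?S n + (if n = 0 then 0 else (v (n - 1))\<^sup>2 / 2) \<le> ?Q n"
  proof (induction n)
    case (Suc n)
    have "0 \<le> (v n + v (n - 1))\<^sup>2" by simp
    then have "- (v n * v (n - 1)) \<le> (v n)\<^sup>2 / 2 + (v (n - 1))\<^sup>2 / 2"
      by (simp add: power2_sum)
    then show ?case
      using Suc unfolding step by (auto split: if_splits)
  qed simp
  moreover have "0 \<le> (if n = 0 then 0 else (v (n - 1))\<^sup>2 / 2)" by simp
  ultimately show ?thesis by linarith
qed

lemma mass_row_le:
  fixes i :: nat
  shows
  "(\<Sum>j<n. if i = j then 4 else if i = j + 1 \<or> j = i + 1 then 1 else 0) \<le> (6::real)"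
proof -
  \<comment> \<open>For \<open>i = 0\<close> truncated subtraction gives \<open>i - 1 = i\<close>;
    the extra term only enlarges the majorant.\<close>
  have "(\<Sum>j<n. if i = j then 4 else if i = j + 1 \<or> j = i + 1 then 1 else (0::real))
     \<le> (\<Sum>j<n. (if j = i then 4 else 0) + (if j = i + 1 then 1 else 0) + (if j = i - 1 then 1 else 0))"
    by (rule sum_mono) auto
  also have "\<dots> \<le> 6"
    unfolding sum.distrib by (simp add: sum.delta)
  finally show ?thesis .
qed

section \<open>The fractional matrices\<close>

definition frac_scale :: "real \<Rightarrow> real" where
  "frac_scale \<mu> = 1 / (2 * cos (\<mu> * pi) * Gamma (4 - 2 * \<mu>))"

text \<open>The absolute value unifies the three cases: with \<open>p = 3 - 2 * \<mu>\<close> the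
  stencil gives \<open>2 * 2 powr p - 8\<close> at 0 and
  \<open>3 powr p - 4 * 2 powr p + 6 + 1\<close> at 1.\<close>

lemma frac_coeff_eq_fourth_diff:
  "frac_coeff \<mu> h l = h powr (1 - 2 * \<mu>) * frac_scale \<mu> * fourth_diff (\<lambda>x. \<bar>x\<bar> powr (3 - 2 * \<mu>)) (real l)"
proof -
  have two: "2 * 2 powr (3 - 2 * \<mu>) = (2::real) powr (4 - 2 * \<mu>)" "4 * 2 powr (3 - 2 * \<mu>) = (2::real) powr (5 - 2 * \<mu>)"
    using powr_add[of 2 1 "3 - 2 * \<mu>"] powr_add[of 2 2 "3 - 2 * \<mu>"] by simp_all
  consider "l = 0" | "l = 1" | "2 \<le> l" by linarith
  then show ?thesis
  proof cases
    case 3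
    then show ?thesis
      by (simp add: frac_coeff_def frac_scale_def fourth_diff_def)
  qed (use two in \<open>simp_all add: frac_coeff_def frac_scale_def fourth_diff_def\<close>)
qed

lemma fourth_diff_abs_minus:
  "fourth_diff (\<lambda>x. f \<bar>x\<bar>) (- d) = fourth_diff (\<lambda>x. f \<bar>x\<bar>) d"
proof -
  have "\<bar>- d + 2\<bar> = \<bar>d - 2\<bar>" "\<bar>- d + 1\<bar> = \<bar>d - 1\<bar>" "\<bar>- d - 1\<bar> = \<bar>d + 1\<bar>" "\<bar>- d - 2\<bar> = \<bar>d + 2\<bar>"
    by auto
  then show ?thesis by (simp add: fourth_diff_def)
qed

text \<open>Evenness replaces the distance of the indices by the signed difference, the form in
  which the cosine kernel factorises.\<close>

lemma frac_coeff_eq_fourth_diff_index: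
  "frac_coeff \<mu> h (if j \<le> i then i - j else j - i)
    = h powr (1 - 2 * \<mu>) * frac_scale \<mu> * fourth_diff (\<lambda>x. \<bar>x\<bar> powr (3 - 2 * \<mu>)) (real i - real j)"
proof (cases "j \<le> i")
  case False
  then have "real (j - i) = - (real i - real j)" by simp
  then show ?thesis
    using False fourth_diff_abs_minus[of "\<lambda>x. x powr (3 - 2 * \<mu>)" "real i - real j"]
    by (simp only: frac_coeff_eq_fourth_diff if_False)
qed (simp add: frac_coeff_eq_fourth_diff of_nat_diff)

text \<open>The scale and the form have compatible signs: for \<open>\<mu> < 1 / 2\<close> the
  exponent exceeds 2 and neither is negative; for \<open>\<mu> > 1 / 2\<close> it is below 2 and
  neither is positive.\<close>

lemma frac_form_nonneg:
  fixes v :: "nat \<Rightarrow> real"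
  assumes \<mu>: "0 < \<mu>" "\<mu> < 1" "\<mu> \<noteq> 1 / 2"
  shows "0 \<le> (\<Sum>i<n. \<Sum>j<n. frac_coeff \<mu> h (if j \<le> i then i - j else j - i) * v i * v j)"
proof -
  let ?Q = "\<Sum>i<n. \<Sum>j<n. fourth_diff (\<lambda>x. \<bar>x\<bar> powr (3 - 2 * \<mu>)) (real i - real j) * v i * v j"
  have G: "Gamma (4 - 2 * \<mu>) > 0"
    using \<mu> by (intro Gamma_real_pos) auto
  have "0 \<le> frac_scale \<mu> * ?Q"
  proof (cases "\<mu> < 1 / 2")
    case True
    interpret power_exponent "3 - 2 * \<mu>" 1
      by unfold_locales (use True \<mu> in auto)
    have "cos (\<mu> * pi) > 0"
      using True \<mu> by (intro cos_gt_zero) auto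
    then have "frac_scale \<mu> > 0" using G by (simp add: frac_scale_def)
    then show ?thesis using fourth_diff_powr_form_sign[of v n] by simp
  next
    case False
    interpret power_exponent "3 - 2 * \<mu>" 0
      by unfold_locales (use False \<mu> in auto)
    have "cos (pi - \<mu> * pi) > 0"
      using False \<mu> by (intro cos_gt_zero) (auto simp: algebra_simps)
    then have "frac_scale \<mu> < 0" using G
      by (simp add: frac_scale_def divide_neg_pos mult_neg_pos divide_less_0_iff)
    then show ?thesis using fourth_diff_powr_form_sign[of v n]
      by (simp add: mult_nonpos_nonpos)
  qed
  then have "0 \<le> h powr (1 - 2 * \<mu>) * (frac_scale \<mu> * ?Q)" by simp
  also have "\<dots> = (\<Sum>i<n. \<Sum>j<n. frac_coeff \<mu> h (if j \<le> i then i - j else j - i) * v i * v j)"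
    unfolding frac_coeff_eq_fourth_diff_index by (simp add: sum_distrib_left mult_ac)
  finally show ?thesis .
qed

text \<open>The step \<open>h\<close> enters only as a prefactor, so summing the full series of
  differences gives a constant valid for all \<open>h\<close>, sizes and rows.\<close>

lemma frac_row_bound:
  assumes \<mu>: "0 < \<mu>"
  obtains B where "B \<ge> 0"
    "\<And>h n i. (\<Sum>j<n. \<bar>frac_coeff \<mu> h (if j \<le> i then i - j else j - i)\<bar>) \<le> h powr (1 - 2 * \<mu>) * B"
proof -
  let ?g = "\<lambda>l. \<bar>fourth_diff (\<lambda>x. \<bar>x\<bar> powr (3 - 2 * \<mu>)) (real l)\<bar>"
  let ?B = "\<bar>frac_scale \<mu>\<bar> * (2 * suminf ?g)"
  have summ: "summable ?g"
    using \<mu> by (intro summable_abs_fourth_diff_powr) auto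
  show thesis
  proof
    show "0 \<le> ?B" using summ by (simp add: suminf_nonneg)
    fix h :: real and n i :: nat
    have "(\<Sum>j<n. \<bar>frac_coeff \<mu> h (if j \<le> i then i - j else j - i)\<bar>)
      = h powr (1 - 2 * \<mu>) * \<bar>frac_scale \<mu>\<bar> * (\<Sum>j<n. ?g (if j \<le> i then i - j else j - i))"
      unfolding frac_coeff_eq_fourth_diff abs_mult sum_distrib_left by simp
    also have "\<dots> \<le> h powr (1 - 2 * \<mu>) * \<bar>frac_scale \<mu>\<bar> * (2 * suminf ?g)"
      by (intro mult_left_mono sum_toeplitz_row_le summ) auto
    finally show "(\<Sum>j<n. \<bar>frac_coeff \<mu> h (if j \<le> i then i - j else j - i)\<bar>) \<le> h powr (1 - 2 * \<mu>) * ?B"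
      by (simp add: mult.assoc)
  qed
qed

text \<open>The semidefinite fractional parts are dropped from the lower bound, leaving
  \<open>m * h / 3\<close> from the mass part; the upper bound adds the row sums of all three
  parts.\<close>

lemma spectral_cond_combination_le:
  assumes \<mu>: "0 < \<beta>" "\<beta> < 1" "\<beta> \<noteq> 1 / 2" "0 < \<gamma>" "\<gamma> < 1" "\<gamma> \<noteq> 1 / 2"
    and M: "2 \<le> M" and h: "0 < h" and coef: "0 < m" "0 \<le> k\<^sub>1" "0 \<le> k\<^sub>2"
    and B\<^sub>1: "\<And>n i. (\<Sum>j<n. \<bar>frac_coeff \<beta> h (if j \<le> i then i - j else j - i)\<bar>) \<le> B\<^sub>1"
    and B\<^sub>2: "\<And>n i. (\<Sum>j<n. \<bar>frac_coeff \<gamma> h (if j \<le> i then i - j else j - i)\<bar>) \<le> B\<^sub>2"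
  shows "spectral_cond (m \<cdot>\<^sub>m mass_matrix M h + k\<^sub>1 \<cdot>\<^sub>m frac_matrix M h \<beta> + k\<^sub>2 \<cdot>\<^sub>m frac_matrix M h \<gamma>)
    \<le> (m * h + k\<^sub>1 * B\<^sub>1 + k\<^sub>2 * B\<^sub>2) / (m * h / 3)"
    (is "spectral_cond ?A \<le> _")
proof -
  define n where "n = M - 1"
  let ?c = "\<lambda>\<mu> i j. frac_coeff \<mu> h (if j \<le> i then i - j else j - i)"
  let ?m = "\<lambda>i j :: nat. if i = j then 4 else if i = j + 1 \<or> j = i + 1 then 1 else 0 :: real"
  have A: "?A \<in> carrier_mat n n"
    by (simp add: n_def mass_matrix_def frac_matrix_def)
  have entry: "?A $$ (i, j) = m * h / 6 * ?m i j + k\<^sub>1 * ?c \<beta> i j + k\<^sub>2 * ?c \<gamma> i j"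
    if "i < n" "j < n" for i j
    using that by (auto simp: n_def mass_matrix_def frac_matrix_def)
  show ?thesis
  proof (rule spectral_cond_le[OF A])
    show "0 < n" using M by (simp add: n_def)
    show "0 < m * h / 3" using coef h by simp
    show "?A $$ (i, j) = ?A $$ (j, i)" if "i < n" "j < n" for i j
      unfolding entry[OF that] entry[OF that(2,1)] by auto
    show "(\<Sum>j<n. \<bar>?A $$ (i, j)\<bar>) \<le> m * h + k\<^sub>1 * B\<^sub>1 + k\<^sub>2 * B\<^sub>2" if i: "i < n" for i
    proof -
      have "(\<Sum>j<n. \<bar>?A $$ (i, j)\<bar>) \<le> (\<Sum>j<n. m * h / 6 * ?m i j + k\<^sub>1 * \<bar>?c \<beta> i j\<bar> + k\<^sub>2 * \<bar>?c \<gamma> i j\<bar>)"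
      proof (rule sum_mono)
        fix j assume "j \<in> {..<n}"
        then have j: "j < n" by simp
        have abs3: "\<bar>x + y + z\<bar> \<le> \<bar>x\<bar> + \<bar>y\<bar> + \<bar>z\<bar>" for x y z :: real by linarith
        have "\<bar>?A $$ (i, j)\<bar> \<le> \<bar>m * h / 6 * ?m i j\<bar> + \<bar>k\<^sub>1 * ?c \<beta> i j\<bar> + \<bar>k\<^sub>2 * ?c \<gamma> i j\<bar>"
          unfolding entry[OF i j] by (rule abs3)
        then show "\<bar>?A $$ (i, j)\<bar> \<le> m * h / 6 * ?m i j + k\<^sub>1 * \<bar>?c \<beta> i j\<bar> + k\<^sub>2 * \<bar>?c \<gamma> i j\<bar>"
          using coef h by (simp add: abs_mult)
      qed
      also have "\<dots> = m * h / 6 * (\<Sum>j<n. ?m i j) + k\<^sub>1 * (\<Sum>j<n. \<bar>?c \<beta> i j\<bar>) + k\<^sub>2 * (\<Sum>j<n. \<bar>?c \<gamma> i j\<bar>)"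
        by (simp only: sum.distrib sum_distrib_left)
      also have "\<dots> \<le> m * h / 6 * 6 + k\<^sub>1 * B\<^sub>1 + k\<^sub>2 * B\<^sub>2"
        using coef h by (intro add_mono mult_left_mono mass_row_le B\<^sub>1 B\<^sub>2) auto
      finally show ?thesis by simp
    qed
    show "m * h / 3 * (\<Sum>i<n. (v i)\<^sup>2) \<le> (\<Sum>i<n. \<Sum>j<n. ?A $$ (i, j) * v i * v j)" for v :: "nat \<Rightarrow> real"
    proof -
      \<comment> \<open>Half of \<open>?m\<close>, so that the prefactor \<open>m * h / 3\<close>
        yields the same mass entries as \<open>m * h / 6\<close> does with
        \<open>?m\<close>.\<close>
      let ?m' = "\<lambda>i j :: nat. if i = j then 2 else if i = j + 1 \<or> j = i + 1 then 1 / 2 else 0 :: real"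
      have "m * h / 3 * (\<Sum>i<n. (v i)\<^sup>2) \<le> m * h / 3 * (\<Sum>i<n. \<Sum>j<n. ?m' i j * v i * v j)"
        using coef h by (intro mult_left_mono mass_form_ge) auto
      also have "\<dots> \<le> m * h / 3 * (\<Sum>i<n. \<Sum>j<n. ?m' i j * v i * v j)
          + k\<^sub>1 * (\<Sum>i<n. \<Sum>j<n. ?c \<beta> i j * v i * v j) + k\<^sub>2 * (\<Sum>i<n. \<Sum>j<n. ?c \<gamma> i j * v i * v j)"
        using frac_form_nonneg[of \<beta> h v n] frac_form_nonneg[of \<gamma> h v n] \<mu> coef by simp
      also have "\<dots> = (\<Sum>i<n. \<Sum>j<n. (m * h / 3 * ?m' i j + k\<^sub>1 * ?c \<beta> i j + k\<^sub>2 * ?c \<gamma> i j) * v i * v j)"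
        by (simp only: sum_distrib_left sum.distrib distrib_right mult.assoc)
      also have "\<dots> = (\<Sum>i<n. \<Sum>j<n. ?A $$ (i, j) * v i * v j)"
        by (intro sum.cong refl) (auto simp: entry)
      finally show ?thesis .
    qed
  qed
qed

section \<open>Uniformity in the step sizes\<close>

lemma is_mesh_step_pos:
  assumes "is_mesh T N t" "1 \<le> n" "n \<le> N"
  shows "0 < t n - t (n - 1)"
  using assms by (cases n) (auto simp: is_mesh_def)

theorem theorem3:
  fixes s :: nat and \<alpha> c :: "nat \<Rightarrow> real" and \<beta> \<gamma> K1 K2 a b T :: real
  assumes "\<And>i. i \<le> s \<Longrightarrow> 0 < \<alpha> i \<and> \<alpha> i < 1"
    and "\<And>i. i < s \<Longrightarrow> \<alpha> (Suc i) < \<alpha> i"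
    and "0 < \<beta>" "\<beta> < 1 / 2"
    and "1 / 2 < \<gamma>" "\<gamma> < 1"
    and "0 < c 0" "\<And>i. 1 \<le> i \<Longrightarrow> i \<le> s \<Longrightarrow> 0 \<le> c i"
    and "0 < K1" "0 < K2"
    and "a < b" "0 < T"
  shows "\<exists>C>0. \<forall>M N :: nat. \<forall>t :: nat \<Rightarrow> real. \<forall>n :: nat.
    2 \<le> M \<longrightarrow> is_mesh T N t \<longrightarrow> 1 \<le> n \<longrightarrow> n \<le> N \<longrightarrow>
    (let h = (b - a) / real M; \<tau> = t n - t (n - 1) in
      spectral_cond (coeff_matrix s \<alpha> c \<beta> \<gamma> K1 K2 M h \<tau>)
        \<le> C * (1 + \<tau> powr \<alpha> 0 * h powr (- 2 * \<gamma>)))"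
proof -
  obtain B\<^sub>1 where B\<^sub>1: "B\<^sub>1 \<ge> 0"
    "\<And>h n i. (\<Sum>j<n. \<bar>frac_coeff \<beta> h (if j \<le> i then i - j else j - i)\<bar>) \<le> h powr (1 - 2 * \<beta>) * B\<^sub>1"
    by (rule frac_row_bound[OF assms(3)]) blast
  have \<gamma>: "0 < \<gamma>" using assms(5) by simp
  obtain B\<^sub>2 where B\<^sub>2: "B\<^sub>2 \<ge> 0"
    "\<And>h n i. (\<Sum>j<n. \<bar>frac_coeff \<gamma> h (if j \<le> i then i - j else j - i)\<bar>) \<le> h powr (1 - 2 * \<gamma>) * B\<^sub>2"
    by (rule frac_row_bound[OF \<gamma>]) blast
  define G where "G = Gamma (3 - \<alpha> 0)"
  have \<alpha>0: "0 < \<alpha> 0" "\<alpha> 0 < 1" using assms(1)[of 0] by auto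
  have G: "G > 0" unfolding G_def using \<alpha>0 by (intro Gamma_real_pos) auto
  define m where "m \<tau> = (\<Sum>i = 0..s. c i * (G * \<tau> powr (\<alpha> 0 - \<alpha> i) / Gamma (3 - \<alpha> i)))" for \<tau>
  \<comment> \<open>The summand for \<open>i = 0\<close> equals \<open>c 0\<close>, as its Gamma
    factors cancel and \<open>\<tau> powr 0 = 1\<close>; the others are nonnegative.\<close>
  have m_ge: "c 0 \<le> m \<tau>" if "\<tau> > 0" for \<tau>
  proof -
    have "c 0 * (G * \<tau> powr (\<alpha> 0 - \<alpha> 0) / Gamma (3 - \<alpha> 0)) \<le> m \<tau>"
      unfolding m_def
    proof (rule member_le_sum)
      fix i assume i: "i \<in> {0..s} - {0}"
      then have "Gamma (3 - \<alpha> i) > 0"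
        using assms(1)[of i] by (intro Gamma_real_pos) auto
      then show "0 \<le> c i * (G * \<tau> powr (\<alpha> 0 - \<alpha> i) / Gamma (3 - \<alpha> i))"
        using i assms(8)[of i] G by simp
    qed auto
    then show ?thesis using G that by (simp flip: G_def)
  qed
  \<comment> \<open>Since \<open>h \<le> b - a\<close>, this factor trades
    \<open>h powr (- 2 * \<beta>)\<close> for \<open>h powr (- 2 * \<gamma>)\<close>.\<close>
  define L where "L = (b - a) powr (2 * (\<gamma> - \<beta>))"
  \<comment> \<open>What remains of the fractional terms once \<open>m \<tau>\<close> is replaced by
    \<open>c 0\<close>; the 3 stems from the lower bound \<open>m * h / 3\<close>.\<close>
  define D where "D = 3 / c 0 * (K1 * (G / 2) * B\<^sub>1 * L + K2 * (G / 2) * B\<^sub>2)"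
  have D: "D \<ge> 0" unfolding D_def L_def using assms(7,9,10) B\<^sub>1(1) B\<^sub>2(1) G by simp
  show ?thesis
  proof (intro exI[of _ "3 + D"] conjI allI impI)
    show "0 < 3 + D" using D by simp
    fix M N t n assume M: "2 \<le> (M::nat)" and mesh: "is_mesh T N t" and n: "1 \<le> n" "n \<le> N"
    define h where "h = (b - a) / real M"
    define \<tau> where "\<tau> = t n - t (n - 1)"
    have h: "0 < h" "h \<le> b - a"
      using M assms(11) divide_left_mono[of 1 "real M" "b - a"] by (auto simp: h_def)
    have \<tau>: "0 < \<tau>" using is_mesh_step_pos[OF mesh n] by (simp add: \<tau>_def)
    have m: "0 < m \<tau>" using m_ge[OF \<tau>] assms(7) by simp
    let ?k1 = "K1 * (G * \<tau> powr \<alpha> 0 / 2)" and ?k2 = "K2 * (G * \<tau> powr \<alpha> 0 / 2)"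
    let ?P1 = "h powr (- 2 * \<beta>)" and ?P2 = "h powr (- 2 * \<gamma>)"
    \<comment> \<open>The factor \<open>h\<close> split off here cancels against that of the mass
      part.\<close>
    have hp: "h powr (1 - 2 * \<mu>) = h * h powr (- 2 * \<mu>)" for \<mu>
      using h powr_add[of h 1 "- 2 * \<mu>"] by simp
    have P1: "?P1 \<le> L * ?P2"
    proof -
      have "?P1 = h powr (2 * (\<gamma> - \<beta>)) * ?P2"
        by (simp add: algebra_simps flip: powr_add)
      also have "\<dots> \<le> L * ?P2"
        unfolding L_def using h assms(4,5) by (intro mult_right_mono powr_mono2) auto
      finally show ?thesis .
    qed
    have "spectral_cond (coeff_matrix s \<alpha> c \<beta> \<gamma> K1 K2 M h \<tau>)
        \<le> (m \<tau> * h + ?k1 * (h powr (1 - 2 * \<beta>) * B\<^sub>1) + ?k2 * (h powr (1 - 2 * \<gamma>) * B\<^sub>2)) / (m \<tau> * h / 3)"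
      unfolding coeff_matrix_def m_def G_def
      by (rule spectral_cond_combination_le)
        (use assms M h m B\<^sub>1 B\<^sub>2 G in \<open>auto simp: m_def G_def\<close>)
    also have "\<dots> = 3 + 3 / m \<tau> * (?k1 * ?P1 * B\<^sub>1 + ?k2 * ?P2 * B\<^sub>2)"
      unfolding hp using m h by (simp add: field_simps)
    also have "\<dots> \<le> 3 + 3 / c 0 * (?k1 * (L * ?P2) * B\<^sub>1 + ?k2 * ?P2 * B\<^sub>2)"
      using m_ge[OF \<tau>] m P1 assms(7,9,10) B\<^sub>1(1) B\<^sub>2(1) G
      by (intro add_left_mono mult_mono divide_left_mono add_right_mono mult_right_mono mult_left_mono) auto
    also have "\<dots> = 3 + D * (\<tau> powr \<alpha> 0 * ?P2)"
      by (simp add: D_def field_simps)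
    also have "\<dots> \<le> (3 + D) * (1 + \<tau> powr \<alpha> 0 * ?P2)"
      using D by (simp add: algebra_simps)
    finally show "let h = (b - a) / real M; \<tau> = t n - t (n - 1) in
      spectral_cond (coeff_matrix s \<alpha> c \<beta> \<gamma> K1 K2 M h \<tau>)
        \<le> (3 + D) * (1 + \<tau> powr \<alpha> 0 * h powr (- 2 * \<gamma>))"
      by (simp add: Let_def h_def \<tau>_def)
  qed
qed

end
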